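(* Let $\zeta:\{0,1\}\to\{0,1\}^{<\mathbb{N}}$ be a coupled substitution and let $V=\lim_{n\to\infty}\zeta^n(0)$. If $V$ is aperiodic, then $V$ does not have a rank-one construction.
   Context: Substitutions: $\{0,1\}^{<\mathbb{N}}$ denotes the set of finite binary words. A substitution is a function $\zeta:\{0,1\}\to\{0,1\}^{<\mathbb{N}}$, extended to words by $\zeta(w_0w_1w_2\cdots)=\zeta(w_0)\zeta(w_1)\zeta(w_2)\cdots$, with the standing assumptions that $\zeta(0)$ starts with $0$ and has length greater than $1$, and $\lim_{n\to\infty}|\zeta^n(1)|=\infty$. Then $V=\lim_n\zeta^n(0)\in\{0,1\}^{\mathbb{N}}$ is the unique fixed point of $\zeta$ starting with $0$. Coupled: for $a\in\{0,1\}$ let $a^c=1-a$. A finite word $u$ is coupled if $u=a_1a_1^c a_2a_2^c\cdots a_ka_k^c$ for some $k\ge1$ and $a_1,\dots,a_k\in\{0,1\}$. The substitution $\zeta$ is coupled if both $\zeta(0)$ and $\zeta(1)$ are coupled. An infinite word $V$ is periodic if $V=vvv\cdots$ for some finite word $v$; aperiodic means not periodic. Rank one: $\mathbb{N}$ is the set of nonnegative integers; $\mathcal{F}$ is the set of all finite words that start and end with $0$; $1^a$ is $a$ consecutive $1$s. A finite word $w$ is built from $v\in\mathcal{F}$ if $w=v1^{a_1}v1^{a_2}\cdots v1^{a_k}v$ for some $k\ge 1$ and $a_i\in\mathbb{N}$. An infinite word $V$ has a rank-one construction if there is a sequence $(v_i)_{i\in\mathbb{N}}$ in $\mathcal{F}$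 with $v_0=0$, $v_{i+1}$ built from $v_i$ for all $i$, and $v_i$ an initial segment of $V$ for all $i$. *)

theory Defs
  imports
    Complex_Main
    "HOL-Library.Omega_Words_Fun"
    "HOL-Library.Z2"
begin

text \<open>
  The letters 0 and 1 are the elements of \<^typ>\<open>bit\<close>, where the complement
  of a letter is literally \<open>1 - a\<close>. Finite words are lists, infinite words
  are functions of type \<^typ>\<open>bit word\<close>.
\<close>

definition subst_ext :: "(bit \<Rightarrow> bit list) \<Rightarrow> bit list \<Rightarrow> bit list" where
  "subst_ext \<zeta> w = concat (map \<zeta> w)"

definition is_substitution :: "(bit \<Rightarrow> bit list) \<Rightarrow> bool" where
  "is_substitution \<zeta> \<longleftrightarrow>
     length (\<zeta> 0) > 1 \<and> hd (\<zeta> 0) = 0 \<and>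
     filterlim (\<lambda>n. length ((subst_ext \<zeta> ^^ n) [1])) at_top sequentially"

text \<open>
  Convergence of finite words to an infinite word is letterwise: every position is
  eventually defined and eventually carries the right letter.
\<close>

definition words_tendsto :: "(nat \<Rightarrow> bit list) \<Rightarrow> bit word \<Rightarrow> bool" where
  "words_tendsto u V \<longleftrightarrow>
     (\<forall>k. \<forall>\<^sub>F n in sequentially. k < length (u n) \<and> u n ! k = V k)"

definition coupled_word :: "bit list \<Rightarrow> bool" where
  "coupled_word u \<longleftrightarrow> (\<exists>as. as \<noteq> [] \<and> u = concat (map (\<lambda>a. [a, 1 - a]) as))"

definition coupled :: "(bit \<Rightarrow> bit list) \<Rightarrow> bool" where
  "coupled \<zeta> \<longleftrightarrow> coupled_word (\<zeta> 0) \<and> coupled_word (\<zeta> 1)"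

definition periodic :: "bit word \<Rightarrow> bool" where
  "periodic V \<longleftrightarrow> (\<exists>v. v \<noteq> [] \<and> V = v\<^sup>\<omega>)"

definition zero_ended :: "bit list set" where
  "zero_ended = {v. v \<noteq> [] \<and> hd v = 0 \<and> last v = 0}"

definition built_from :: "bit list \<Rightarrow> bit list \<Rightarrow> bool" where
  "built_from w v \<longleftrightarrow>
     (\<exists>as :: nat list. as \<noteq> [] \<and> w = concat (map (\<lambda>a. v @ replicate a 1) as) @ v)"

definition has_rank_one_construction :: "bit word \<Rightarrow> bool" where
  "has_rank_one_construction V \<longleftrightarrow>
     (\<exists>v :: nat \<Rightarrow> bit list.
        (\<forall>i. v i \<in> zero_ended) \<and> v 0 = [0] \<and>
        (\<forall>i. built_from (v (Suc i)) (v i)) \<and>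
        (\<forall>i. prefix (length (v i)) V = v i))"

text \<open>The limit word of a substitution always exists and is unique.\<close>

lemma subst_ext_pow_append:
  "(subst_ext \<zeta> ^^ n) (u @ v) = (subst_ext \<zeta> ^^ n) u @ (subst_ext \<zeta> ^^ n) v"
  by (induction n) (simp_all add: subst_ext_def)

lemma words_tendsto_unique:
  assumes "words_tendsto u V" "words_tendsto u W"
  shows "V = W"
proof
  fix k
  have "\<forall>\<^sub>F n in sequentially. k < length (u n) \<and> u n ! k = V k"
    and "\<forall>\<^sub>F n in sequentially. k < length (u n) \<and> u n ! k = W k"
    using assms by (auto simp: words_tendsto_def)
  then have "\<forall>\<^sub>F n in sequentially. V k = W k"
    by eventually_elim auto
  then show "V k = W k" by simp
qed

lemma limit_word_exists:
  assumes "is_substitution \<zeta>"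
  shows "\<exists>!V. words_tendsto (\<lambda>n. (subst_ext \<zeta> ^^ n) [0]) V"
proof -
  define u where "u n = (subst_ext \<zeta> ^^ n) [0]" for n
  define L where "L n = length ((subst_ext \<zeta> ^^ n) [1])" for n
  have z: "length (\<zeta> 0) > 1" "hd (\<zeta> 0) = 0" and lim: "filterlim L at_top sequentially"
    using assms by (auto simp: is_substitution_def L_def[abs_def])
  from z obtain b r where z0: "\<zeta> 0 = 0 # b # r"
    by (cases "\<zeta> 0"; cases "tl (\<zeta> 0)") auto
  have u_Suc: "u (Suc n) = u n @ (subst_ext \<zeta> ^^ n) ([b] @ r)" for n
  proof -
    have "u (Suc n) = (subst_ext \<zeta> ^^ n) ([0] @ [b] @ r)"
      by (simp add: u_def funpow_Suc_right subst_ext_def z0 del: funpow.simps)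
    then show ?thesis by (simp only: subst_ext_pow_append u_def)
  qed
  have ext: "\<exists>w. u m = u n @ w" if "n \<le> m" for n m
    using that by (induction m rule: dec_induct) (auto simp: u_Suc)
  have long: "\<exists>n. k < length (u n)" for k
  proof (induction k)
    case 0
    show ?case by (rule exI[of _ 0]) (simp add: u_def)
  next
    case (Suc k)
    then obtain n where n: "k < length (u n)" by blast
    have "\<forall>\<^sub>F m in sequentially. L m \<ge> 1"
      using lim by (simp add: filterlim_at_top)
    then obtain N where N: "\<And>m. m \<ge> N \<Longrightarrow> L m \<ge> 1"
      by (auto simp: eventually_sequentially)
    define m where "m = max n N"
    obtain w where w: "u m = u n @ w" using ext[of n m] by (auto simp: m_def)
    have "(subst_ext \<zeta> ^^ m) [b] \<noteq> []"
    proof (cases b)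
      case zero
      obtain w' where "u m = u 0 @ w'" using ext[of 0 m] by auto
      then show ?thesis using zero by (auto simp: u_def)
    next
      case one
      then show ?thesis using N[of m] by (auto simp: L_def m_def)
    qed
    then have "0 < length ((subst_ext \<zeta> ^^ m) [b])" by simp
    moreover have "length (u (Suc m)) = length (u n) + length w +
        (length ((subst_ext \<zeta> ^^ m) [b]) + length ((subst_ext \<zeta> ^^ m) r))"
      unfolding u_Suc subst_ext_pow_append w by simp
    ultimately have "Suc k < length (u (Suc m))" using n by linarith
    then show ?case by blast
  qed
  then obtain f where f: "\<And>k. k < length (u (f k))" by metis
  have "k < length (u n) \<and> u n ! k = u (f k) ! k" if "f k \<le> n" for k n
    using ext[OF that] f[of k] by (auto simp: nth_append)
  then have "words_tendsto u (\<lambda>k. u (f k) ! k)"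
    unfolding words_tendsto_def eventually_sequentially by blast
  then show ?thesis
    unfolding u_def[abs_def] by (blast intro: words_tendsto_unique)
qed

end

(*
  A coupled infinite word V satisfies V (2k+1) = 1 - V (2k). If V is aperiodic, it is not
  0101..., so V j = V (j+1) for some j, and j is odd. Take a word v of the rank-one
  construction that is longer than j+1. As v contains a repeated letter at an odd position,
  it can occur in V at even positions only. Hence in V = v 1^{a_1} v 1^{a_2} ... each a_i
  has the parity of |v|, and a_i >= 2 + (|v| mod 2) would put 11 at an even position. So all
  a_i are equal to |v| mod 2 and V is periodic after all.
*)
theory Submission
  imports Defs
begin

definition occurs_at :: "'a list \<Rightarrow> 'a word \<Rightarrow> nat \<Rightarrow> bool" where
  "occurs_at u V p \<longleftrightarrow> (\<forall>n < length u. V (p + n) = u ! n)"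

lemma occurs_at_append:
  "occurs_at (u @ w) V p \<longleftrightarrow> occurs_at u V p \<and> occurs_at w V (p + length u)"
proof
  assume *: "occurs_at (u @ w) V p"
  have "V (p + n) = u ! n" if "n < length u" for n
    using *[unfolded occurs_at_def, rule_format, of n] that by (simp add: nth_append)
  moreover have "V (p + length u + n) = w ! n" if "n < length w" for n
    using *[unfolded occurs_at_def, rule_format, of "length u + n"] that
    by (simp add: nth_append add.assoc)
  ultimately show "occurs_at u V p \<and> occurs_at w V (p + length u)"
    by (auto simp: occurs_at_def)
next
  assume *: "occurs_at u V p \<and> occurs_at w V (p + length u)"
  have "V (p + n) = (u @ w) ! n" if "n < length (u @ w)" for n
  proof (cases "n < length u")
    case True
    then show ?thesis using * by (auto simp: occurs_at_def nth_append)
  next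
    case False
    then obtain m where "n = length u + m" by (metis le_Suc_ex not_less)
    then show ?thesis using * that by (auto simp: occurs_at_def nth_append add.assoc)
  qed
  then show "occurs_at (u @ w) V p" by (auto simp: occurs_at_def)
qed

lemma occurs_at_prefix: "prefix (length u) V = u \<Longrightarrow> occurs_at u V 0"
  unfolding occurs_at_def by (metis add.left_neutral subsequence_nth diff_zero)

text \<open>Reads a period off finite evidence: if \<open>V\<close> begins with arbitrarily high
  powers of \<open>c\<close>, the case \<open>p = 0\<close> yields every letter of \<open>V\<close>
  as a letter of the infinite power of \<open>c\<close>.\<close>

lemma occurs_at_power_nth:
  assumes "occurs_at (concat (replicate k c)) V p" "n < k * length c"
  shows "V (p + n) = c ! (n mod length c)"
  using assms
proof (induction k arbitrary: p n)
  case 0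
  then show ?case by simp
next
  case (Suc k)
  from Suc.prems(1) have c: "occurs_at c V p"
    and cs: "occurs_at (concat (replicate k c)) V (p + length c)"
    by (simp_all add: occurs_at_append)
  show ?case
  proof (cases "n < length c")
    case True
    then show ?thesis using c by (simp add: occurs_at_def)
  next
    case False
    then obtain m where "n = length c + m" by (metis le_Suc_ex not_less)
    with Suc.IH[OF cs, of m] Suc.prems(2) show ?thesis by (simp add: add.assoc)
  qed
qed

text \<open>Unlike in \<open>built_from\<close>, the list of spacers may be empty. This makes the
  relation reflexive, so that inductions can start from \<open>v\<close> itself.\<close>

definition chain :: "bit list \<Rightarrow> nat list \<Rightarrow> bit list" where
  "chain v as = concat (map (\<lambda>a. v @ replicate a 1) as) @ v"

lemma chain_Nil [simp]: "chain v [] = v"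
  and chain_Cons [simp]: "chain v (a # as) = v @ replicate a 1 @ chain v as"
  by (simp_all add: chain_def)

lemma chain_append: "chain v (as @ b # bs) = chain v as @ replicate b 1 @ chain v bs"
  by (simp add: chain_def)

text \<open>Transitivity of being built: expanding each inner chain leaves copies of
  \<open>v\<close>, and the outer spacers simply join the inner ones.\<close>

lemma chain_chain: "\<exists>cs. chain (chain v as) bs = chain v cs"
proof (induction bs)
  case Nil
  show ?case by auto
next
  case (Cons b bs)
  then show ?case by (metis chain_Cons chain_append)
qed

lemma length_chain: "length v \<le> length (chain v as)"
  by (simp add: chain_def)

lemma occurs_at_chainD: "occurs_at (chain v as) V p \<Longrightarrow> occurs_at v V p"
  by (cases as) (auto simp: occurs_at_append)

definition coupled_seq :: "bit word \<Rightarrow> bool" where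
  "coupled_seq V \<longleftrightarrow> (\<forall>k. V (Suc (2 * k)) = 1 - V (2 * k))"

lemma one_minus_bit_neq: "1 - a \<noteq> (a :: bit)"
  by (cases a) auto

lemma coupled_seq_even_neq: "coupled_seq V \<Longrightarrow> even q \<Longrightarrow> V (Suc q) \<noteq> V q"
  by (metis coupled_seq_def dvd_def one_minus_bit_neq)

lemma nth_pairs:
  "Suc (2 * k) < length (concat (map (\<lambda>a. [a, 1 - a]) as)) \<Longrightarrow>
   concat (map (\<lambda>a. [a, 1 - a]) as) ! Suc (2 * k) =
     1 - concat (map (\<lambda>a. [a, 1 - a :: bit]) as) ! (2 * k)"
proof (induction as arbitrary: k)
  case Nil
  then show ?case by simp
next
  case (Cons a as)
  then show ?case by (cases k) auto
qed

text \<open>\<open>coupled_word\<close> would be too strong here, since it excludes the empty word,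
  the image of \<open>[]\<close>.\<close>

lemma subst_ext_coupled:
  assumes "coupled \<zeta>"
  shows "\<exists>as. subst_ext \<zeta> w = concat (map (\<lambda>a. [a, 1 - a]) as)"
proof (induction w)
  case Nil
  show ?case by (auto simp: subst_ext_def intro: exI[of _ "[]"])
next
  case (Cons b w)
  obtain as where "\<zeta> b = concat (map (\<lambda>a. [a, 1 - a]) as)"
    using assms by (cases b) (auto simp: coupled_def coupled_word_def)
  moreover obtain bs where "subst_ext \<zeta> w = concat (map (\<lambda>a. [a, 1 - a]) bs)"
    using Cons.IH by blast
  ultimately have "subst_ext \<zeta> (b # w) = concat (map (\<lambda>a. [a, 1 - a]) (as @ bs))"
    by (simp add: subst_ext_def)
  then show ?case by blast
qed

lemma coupled_seq_limit:
  assumes "coupled \<zeta>" "words_tendsto (\<lambda>n. (subst_ext \<zeta> ^^ n) w) V"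
  shows "coupled_seq V"
  unfolding coupled_seq_def
proof
  fix k
  let ?u = "\<lambda>n. (subst_ext \<zeta> ^^ n) w"
  have "\<forall>\<^sub>F n in sequentially. Suc (2 * k) < length (?u n) \<and> ?u n ! Suc (2 * k) = V (Suc (2 * k))"
    and "\<forall>\<^sub>F n in sequentially. 2 * k < length (?u n) \<and> ?u n ! (2 * k) = V (2 * k)"
    using assms(2) unfolding words_tendsto_def by blast+
  \<comment> \<open>The case \<open>n = 0\<close> is left out because \<open>w\<close> itself need
    not split into complementary pairs; every later iterate is an image under
    \<open>subst_ext \<zeta>\<close>.\<close>
  with eventually_gt_at_top[of 0] have "\<forall>\<^sub>F n in sequentially. V (Suc (2 * k)) = 1 - V (2 * k)"
  proof eventually_elim
    case (elim n)
    then obtain m where "n = Suc m" by (auto dest: gr0_implies_Suc)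
    then obtain as where "?u n = concat (map (\<lambda>a. [a, 1 - a]) as)"
      using subst_ext_coupled[OF assms(1), of "?u m"] by auto
    with elim nth_pairs[of k as] show ?case by simp
  qed
  then show "V (Suc (2 * k)) = 1 - V (2 * k)" by simp
qed

text \<open>With only two letters, to differ from the previous letter is to be its complement, so
  \<open>V 0\<close> determines all of \<open>V\<close>.\<close>

lemma alternating_periodic:
  assumes "\<And>j. V (Suc j) \<noteq> (V j :: bit)"
  shows "periodic V"
proof -
  have step: "V (Suc j) = 1 - V j" for j
    using assms[of j] by (cases "V j"; cases "V (Suc j)") auto
  define b where "b = V 0"
  have alt: "V j = (if even j then b else 1 - b)" for j
  proof (induction j)
    case (Suc j)
    show ?case unfolding step Suc.IH by (cases "even j"; cases b) simp_all
  qed (simp add: b_def)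
  have "V j = [b, 1 - b] ! (j mod 2)" for j
  proof (cases "even j")
    case True
    then have "j mod 2 = 0" by presburger
    with True alt[of j] show ?thesis by (simp only: nth_Cons_0 if_True)
  next
    case False
    then have "j mod 2 = Suc 0" by presburger
    with False alt[of j] show ?thesis by (simp only: nth_Cons_0 nth_Cons_Suc if_False)
  qed
  then have "V = [b, 1 - b]\<^sup>\<omega>" by (simp add: iter_def fun_eq_iff numeral_2_eq_2)
  then show ?thesis unfolding periodic_def by blast
qed

text \<open>The position \<open>j\<close> is odd by coupling. An occurrence at an odd
  \<open>p\<close> would move the repeated letter to the even position \<open>p + j\<close>, where
  coupling forbids it.\<close>

lemma even_occurrence:
  assumes "coupled_seq V" "occurs_at v V 0" "V (Suc j) = V j" "Suc j < length v"
    and "occurs_at v V p"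
  shows "even p"
proof (rule ccontr)
  assume "odd p"
  moreover have "odd j" using coupled_seq_even_neq[OF assms(1)] assms(3) by blast
  ultimately have "V (Suc (p + j)) \<noteq> V (p + j)"
    using coupled_seq_even_neq[OF assms(1), of "p + j"] by simp
  moreover have "V (p + i) = V i" if "i < length v" for i
    using assms(2,5) that by (simp add: occurs_at_def)
  ultimately show False using assms(3,4) by (metis Suc_lessD add_Suc_right)
qed

text \<open>Consecutive copies of \<open>v\<close> start at even positions, which fixes the parity
  of each spacer; coupling then bounds its length. Keeping \<open>p\<close> arbitrary lets the
  induction pass to the rest of the chain, which starts later in \<open>V\<close>.\<close>

lemma chain_spacers_const:
  assumes V: "coupled_seq V"
    and v: "\<And>p. occurs_at v V p \<Longrightarrow> even p"
    and "occurs_at (chain v as) V p"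
  shows "as = replicate (length as) (length v mod 2)"
  using assms(3)
proof (induction as arbitrary: p)
  case Nil
  then show ?case by simp
next
  case (Cons a as)
  let ?e = "length v mod 2"
  from Cons.prems have p: "occurs_at v V p"
    and ones: "occurs_at (replicate a 1) V (p + length v)"
    and rest: "occurs_at (chain v as) V (p + length v + a)"
    by (simp_all add: occurs_at_append add.assoc)
  have "even p" "even (p + length v + a)"
    using v p occurs_at_chainD[OF rest] by blast+
  then have par: "a mod 2 = ?e" by presburger
  have "a < ?e + 2"
  proof (rule ccontr)
    assume "\<not> a < ?e + 2"
    \<comment> \<open>Offset \<open>?e\<close> is the first one in the spacer that rounds
      \<open>p + length v\<close> up to an even position; a spacer of length at least
      \<open>?e + 2\<close> also covers the next letter.\<close>
    then have "V (p + length v + ?e) = 1" "V (p + length v + Suc ?e) = 1"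
      using ones by (auto simp: occurs_at_def simp del: add_Suc_right)
    moreover have "even (p + length v + ?e)" using \<open>even p\<close> by presburger
    ultimately show False using coupled_seq_even_neq[OF V] by fastforce
  qed
  with par have "a = ?e" by presburger
  with Cons.IH[OF rest] show ?case by simp
qed

lemma rank_one_coupled_periodic:
  assumes V: "coupled_seq V" and "has_rank_one_construction V"
  shows "periodic V"
proof (rule ccontr)
  assume aper: "\<not> periodic V"
  obtain v where v0: "v 0 = [0]"
    and built: "\<And>i. built_from (v (Suc i)) (v i)"
    and pre: "\<And>i. prefix (length (v i)) V = v i"
    using assms(2) unfolding has_rank_one_construction_def by blast
  obtain j where j: "V (Suc j) = V j" using alternating_periodic aper by blast
  have occ: "occurs_at (v i) V 0" for i
    using occurs_at_prefix pre by blast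
  have step: "\<exists>as. as \<noteq> [] \<and> v (Suc i) = chain (v i) as" for i
    using built[of i] by (auto simp: built_from_def chain_def)
  have len: "i < length (v i)" for i
  proof (induction i)
    case 0
    show ?case by (simp add: v0)
  next
    case (Suc i)
    \<comment> \<open>A nonempty spacer list means at least two copies of \<open>v i\<close>, which
      is itself nonempty by the induction hypothesis, so the length grows strictly.\<close>
    obtain a as where "v (Suc i) = chain (v i) (a # as)"
      using step[of i] by (metis neq_Nil_conv)
    with length_chain[of "v i" as] Suc show ?case by simp
  qed
  \<comment> \<open>By \<open>len\<close> this word is longer than \<open>Suc j\<close>, so it
    contains both equal letters at \<open>j\<close> and \<open>Suc j\<close>.\<close>
  let ?w = "v (Suc j)"
  \<comment> \<open>The future period: \<open>?w\<close> followed by the only spacer that parity and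
    coupling permit.\<close>
  define c where "c = ?w @ replicate (length ?w mod 2) 1"
  have chain: "\<exists>as. v (Suc j + d) = chain ?w as" for d
  proof (induction d)
    case 0
    show ?case by (auto intro: exI[of _ "[]"])
  next
    case (Suc d)
    then show ?case using step[of "Suc j + d"] chain_chain by (metis add_Suc_right)
  qed
  have "V n = c ! (n mod length c)" for n
  proof -
    \<comment> \<open>The index is chosen so that \<open>?u\<close> is longer than
      \<open>n + length ?w\<close>; hence position \<open>n\<close> still lies in the power of
      \<open>c\<close>, before the final copy of \<open>?w\<close>.\<close>
    let ?u = "v (Suc j + (n + length ?w))"
    obtain as where as: "?u = chain ?w as" using chain by blast
    have "as = replicate (length as) (length ?w mod 2)"
    proof (rule chain_spacers_const[OF V])
      show "even p" if "occurs_at ?w V p" for p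
        using even_occurrence[OF V occ j len that] .
      show "occurs_at (chain ?w as) V 0" using occ[of "Suc j + (n + length ?w)"] as by simp
    qed
    then have u: "?u = concat (replicate (length as) c) @ ?w"
      unfolding as chain_def c_def by (metis map_replicate)
    have "occurs_at (concat (replicate (length as) c)) V 0"
      using occ[of "Suc j + (n + length ?w)"] unfolding u occurs_at_append by blast
    moreover have "n < length as * length c"
      using len[of "Suc j + (n + length ?w)"] unfolding u
      by (simp add: length_concat sum_list_replicate)
    ultimately show ?thesis using occurs_at_power_nth[of "length as" c V 0 n] by simp
  qed
  moreover have "c \<noteq> []" using len[of "Suc j"] by (auto simp: c_def)
  ultimately have "c \<noteq> [] \<and> V = c\<^sup>\<omega>" by (auto simp: iter_def)
  then show False using aper unfolding periodic_def by blast
qed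

theorem corollary3p20:
  fixes \<zeta> :: "bit \<Rightarrow> bit list" and V :: "bit word"
  assumes "is_substitution \<zeta>"
    and "coupled \<zeta>"
    and "words_tendsto (\<lambda>n. (subst_ext \<zeta> ^^ n) [0]) V"
    and "\<not> periodic V"
  shows "\<not> has_rank_one_construction V"
  using rank_one_coupled_periodic coupled_seq_limit[OF assms(2,3)] assms(4) by blast

end
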